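(* Let $d\ge 1$, let $\Omega=(0,1)^d$ be endowed with the uniform probability measure, and let $f:\Omega\to\mathbb{R}$ be a square-integrable bounded function with continuous second-order partial derivatives and variance $\sigma^2=\mathrm{Var}(f)>0$, such that all entries of the matrix $\mathbf{C}_{\rm gas}$ are well-defined (finite). Then for every $i=1,\ldots,d$, $$\bar S_i\le \frac12\,\frac{\gamma_i(d)}{\sigma^2},$$ where $\bar S_i$ is the upper Sobol' index of the $i$th input and $\gamma_i(d)$ is the global activity score of the $i$th parameter with $m=d$.
   Context: Notation: for $\mathbf v,\mathbf z\in\mathbb{R}^d$, $(\mathbf v_{\{i\}}{:}\mathbf z_{-\{i\}})$ is the vector whose $i$th component is $v_i$ and whose $j$th component is $z_j$ for $j\ne i$. Upper Sobol' index: let $f(\mathbf x)=\sum_{u\subseteq\{1,\ldots,d\}}f_u(\mathbf x)$ be the ANOVA decomposition of $f$ on $(0,1)^d$ with the uniform measure ($f_\emptyset=\int f\,d\mathbf x$ and, inductively, $f_u$ is the integral of $f$ over the variables not in $u$ minus $\sum_{v\subsetneq u}f_v$), let $\sigma_u^2$ be the variance of $f_u$, and $\sigma^2=\mathrm{Var}(f)=\sum_u\sigma_u^2$. Then $\bar S_i=\frac1{\sigma^2}\sum_{u\ni i}\sigma_u^2$; equivalently (known formula of Sobol') $$\bar S_i=\frac{1}{2\sigma^2}\int \big(f(\mathbf z)-f(\mathbf v_{\{i\}}{:}\mathbf z_{-\{i\}})\big)^2\,d\mathbf z\,dv_i .$$ Global activity scores: let $\mathbf v,\mathbf z$ be independent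 random vectors, both uniformly distributed on $\Omega$. Define $$D_{\mathbf z,i}f(v_i,\mathbf z)=\frac{f(\mathbf v_{\{i\}}{:}\mathbf z_{-\{i\}})-f(\mathbf z)}{v_i-z_i},\qquad D_{\mathbf z}f(\mathbf v,\mathbf z)=[D_{\mathbf z,1}f(v_1,\mathbf z),\ldots,D_{\mathbf z,d}f(v_d,\mathbf z)]^T,$$ (defined almost surely), and the $d\times d$ symmetric positive semidefinite matrix $$\mathbf C_{\rm gas}=\mathbb{E}\big[\mathbb{E}[(D_{\mathbf z}f)(D_{\mathbf z}f)^T\mid \mathbf z]\big].$$ Let $\mathbf C_{\rm gas}=\mathbf U\Lambda\mathbf U^T$ be an eigenvalue decomposition, with $\mathbf U=[\mathbf u_1,\ldots,\mathbf u_d]$ orthogonal, $\mathbf u_j=[u_{1j},\ldots,u_{dj}]^T$, and $\Lambda=\mathrm{diag}(\lambda_1,\ldots,\lambda_d)$, $\lambda_1\ge\cdots\ge\lambda_d\ge0$. For $m\le d$ the global activity score of the $i$th parameter is $\gamma_i(m)=\sum_{j=1}^m\lambda_j u_{ij}^2$. *)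

theory Defs
  imports "HOL-Probability.Probability"
begin

definition unit_cube :: "(real ^ 'n::finite) set" where
  "unit_cube = {x. \<forall>i. 0 < x $ i \<and> x $ i < 1}"

text \<open>The uniform measure lives on the cube itself: a function given on \<open>unit_cube\<close> is represented
  by a total function whose values elsewhere are irrelevant, also for measurability.\<close>

definition unif :: "(real ^ 'n::finite) measure" where
  "unif = restrict_space (uniform_measure lborel unit_cube) unit_cube"

text \<open>\<open>mix u v z\<close> is the vector \<open>(v\<^sub>u : z\<^sub>-\<^sub>u)\<close>.\<close>

definition mix :: "'n set \<Rightarrow> real ^ 'n::finite \<Rightarrow> real ^ 'n \<Rightarrow> real ^ 'n" where
  "mix u v z = (\<chi> j. if j \<in> u then v $ j else z $ j)"

definition has_partial_derivative ::
    "(real ^ 'n::finite \<Rightarrow> real) \<Rightarrow> 'n \<Rightarrow> real \<Rightarrow> real ^ 'n \<Rightarrow> bool" where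
  "has_partial_derivative f i D x \<longleftrightarrow>
     ((\<lambda>t. f (x + t *\<^sub>R axis i 1)) has_real_derivative D) (at 0)"

definition cont_second_partials_on :: "(real ^ 'n::finite) set \<Rightarrow> (real ^ 'n \<Rightarrow> real) \<Rightarrow> bool" where
  "cont_second_partials_on S f \<longleftrightarrow>
     (\<exists>g h. (\<forall>i. \<forall>x\<in>S. has_partial_derivative f i (g i x) x) \<and>
            (\<forall>i j. \<forall>x\<in>S. has_partial_derivative (g i) j (h i j x) x) \<and>
            (\<forall>i j. continuous_on S (h i j)))"

text \<open>ANOVA components. The integrand depends on \<open>z\<close> only through the variables outside \<open>u\<close>, so under
  the uniform probability measure the integral is the one over those variables alone.\<close>

function anova :: "(real ^ 'n::finite \<Rightarrow> real) \<Rightarrow> 'n set \<Rightarrow> real ^ 'n \<Rightarrow> real" where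
  "anova f u x = (\<integral>z. f (mix u x z) \<partial>unif) - (\<Sum>v\<in>{v. v \<subset> u}. anova f v x)"
  by pat_completeness auto
termination
  by (relation "Wellfounded.measure (\<lambda>(f, u, x). card u)") (auto intro: psubset_card_mono)

declare anova.simps [simp del]

definition var :: "(real ^ 'n::finite \<Rightarrow> real) \<Rightarrow> real" where
  "var g = prob_space.variance unif g"

definition upper_sobol :: "(real ^ 'n::finite \<Rightarrow> real) \<Rightarrow> 'n \<Rightarrow> real" where
  "upper_sobol f i = (1 / var f) * (\<Sum>u\<in>{u. i \<in> u}. var (anova f u))"

text \<open>The junk value at \<open>v\<^sub>i = z\<^sub>i\<close> concerns a null set only.\<close>

definition gas_D :: "(real ^ 'n::finite \<Rightarrow> real) \<Rightarrow> real ^ 'n \<Rightarrow> real ^ 'n \<Rightarrow> real ^ 'n" where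
  "gas_D f v z = (\<chi> i. (f (mix {i} v z) - f z) / (v $ i - z $ i))"

text \<open>The joint law of \<open>(v, z)\<close>, and the sub-sigma-algebra generated by \<open>z\<close>.\<close>

definition vz_space :: "((real ^ 'n::finite) \<times> (real ^ 'n)) measure" where
  "vz_space = unif \<Otimes>\<^sub>M unif"

definition sigma_z :: "((real ^ 'n::finite) \<times> (real ^ 'n)) measure" where
  "sigma_z = vimage_algebra (space vz_space) snd unif"

definition gas_integrand ::
    "(real ^ 'n::finite \<Rightarrow> real) \<Rightarrow> 'n \<Rightarrow> 'n \<Rightarrow> (real ^ 'n) \<times> (real ^ 'n) \<Rightarrow> real" where
  "gas_integrand f i j = (\<lambda>(v, z). gas_D f v z $ i * gas_D f v z $ j)"

definition C_gas_finite :: "(real ^ 'n::finite \<Rightarrow> real) \<Rightarrow> bool" where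
  "C_gas_finite f \<longleftrightarrow> (\<forall>i j. integrable vz_space (gas_integrand f i j))"

definition C_gas :: "(real ^ 'n::finite \<Rightarrow> real) \<Rightarrow> real ^ 'n ^ 'n" where
  "C_gas f = (\<chi> i j. \<integral>p. real_cond_exp vz_space sigma_z (gas_integrand f i j) p \<partial>vz_space)"

definition diag_matrix :: "real ^ 'n::finite \<Rightarrow> real ^ 'n ^ 'n" where
  "diag_matrix l = (\<chi> i j. if i = j then l $ i else 0)"

text \<open>The linear order on the index type plays the role of the order of \<open>1, \<dots>, d\<close>.
  Column \<open>j\<close> of \<open>U\<close> is the eigenvector for \<open>l $ j\<close>.\<close>

definition eigenvalue_decomposition ::
    "real ^ 'n::{finite,linorder} ^ 'n::{finite,linorder} \<Rightarrow> real ^ 'n::{finite,linorder} ^ 'n::{finite,linorder} \<Rightarrow> real ^ 'n::{finite,linorder} \<Rightarrow> bool" where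
  "eigenvalue_decomposition C U l \<longleftrightarrow>
     orthogonal_matrix U \<and> C = U ** diag_matrix l ** transpose U \<and>
     (\<forall>j k. j \<le> k \<longrightarrow> l $ j \<ge> l $ k) \<and> (\<forall>j. l $ j \<ge> 0)"

text \<open>\<open>card {..j}\<close> is the position of \<open>j\<close> in the order, counted from 1, so the sum runs over the first
  \<open>m\<close> indices.\<close>

definition activity_score ::
    "real ^ 'n::{finite,linorder} ^ 'n::{finite,linorder} \<Rightarrow> real ^ 'n::{finite,linorder} \<Rightarrow> 'n \<Rightarrow> nat \<Rightarrow> real" where
  "activity_score U l i m = (\<Sum>j\<in>{j. card {..j} \<le> m}. l $ j * (U $ i $ j)\<^sup>2)"

end

theory Submission
  imports Defs
begin

text \<open>Put \<open>\<Delta> = f (v\<^sub>i : z\<^sub>-\<^sub>i) - f z\<close> for independent uniform points \<open>v\<close> and \<open>z\<close>. The \<open>i\<close>th diagonal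
  entry of \<open>C\<^sub>g\<^sub>a\<^sub>s\<close> is the mean of \<open>(\<Delta> / (v\<^sub>i - z\<^sub>i))\<^sup>2\<close>, and it equals the activity score with all
  eigenvalues included (\<open>C_gas_entry\<close>, \<open>activity_score_full\<close>). By Sobol's formula,
  the squared norms of the ANOVA components whose index set contains \<open>i\<close> add up to half the mean of
  \<open>\<Delta>\<^sup>2\<close> (\<open>sum_anova_sq_eq\<close>). Since two points of the unit interval are at distance at most one,
  \<open>\<Delta>\<^sup>2 \<le> (\<Delta> / (v\<^sub>i - z\<^sub>i))\<^sup>2\<close> pointwise (\<open>sq_increment_le_gas_integrand\<close>), and
  the theorem follows by integrating.

  The work lies in Sobol's formula. Let \<open>P\<^sub>u f\<close> be the average of \<open>f\<close> over the coordinates outside \<open>u\<close>.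
  The joint law of two independent uniform points does not change when they exchange some of their
  coordinates (\<open>distr_vz_swap_outside\<close>). Hence \<open>P\<^sub>u\<close> is self-adjoint and \<open>P\<^sub>u P\<^sub>v = P\<^sub>u\<^sub>\<inter>\<^sub>v\<close>, so that the inner
  product of \<open>P\<^sub>u f\<close> and \<open>P\<^sub>v f\<close> depends on \<open>u \<inter> v\<close> only. The definition of the ANOVA components says
  that \<open>P\<^sub>u f\<close> is the sum of the components with index set inside \<open>u\<close>, and from these two facts their
  orthogonality is pure combinatorics of subsets (\<open>anova_orthogonal\<close>). By Pythagoras the squared norms
  of the components with \<open>i \<in> u\<close> add up to \<open>\<parallel>f\<parallel>\<^sup>2 - \<parallel>P\<^sub>-\<^sub>i f\<parallel>\<^sup>2\<close>, where \<open>-i\<close> stands for all coordinates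
  except \<open>i\<close>; expanding the square shows that this is half the mean of \<open>\<Delta>\<^sup>2\<close>. The variance of a
  component is at most its squared norm.

  All integrals exist because \<open>f\<close> is bounded and measurable on the cube. Measurability comes from the
  derivatives: existing partial derivatives with continuous partial derivatives of their own make the
  first partials, and then \<open>f\<close> itself, continuous (\<open>continuous_on_if_cont_second_partials_on\<close>).\<close>

section \<open>The uniform measure on the cube\<close>

lemma unit_cube_eq_box: "unit_cube = box 0 (1 :: real ^ 'n::finite)"
  by (auto simp: unit_cube_def mem_box_cart)

lemma unit_cube_open: "open unit_cube"
  by (simp add: unit_cube_eq_box open_box)

lemma unit_cube_borel [measurable]: "unit_cube \<in> sets borel"
  by (simp add: unit_cube_eq_box)

lemma prod_Basis_cart: "(\<Prod>b\<in>Basis. (x :: real ^ 'n::finite) \<bullet> b) = (\<Prod>i\<in>UNIV. x $ i)"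
proof -
  have "(\<Prod>b\<in>Basis. x \<bullet> b) = (\<Prod>b\<in>range (\<lambda>i. axis i 1). x \<bullet> b)"
    by (intro prod.cong) (auto simp: Basis_vec_def)
  also have "\<dots> = (\<Prod>i\<in>UNIV. x \<bullet> axis i 1)"
    by (subst prod.reindex) (auto simp: inj_on_def axis_eq_axis)
  finally show ?thesis by (simp add: inner_axis)
qed

lemma emeasure_lborel_unit_cube: "emeasure lborel (unit_cube :: (real ^ 'n::finite) set) = 1"
proof -
  have "(\<Prod>b\<in>Basis. (1 :: real ^ 'n) \<bullet> b) = 1" by (simp only: prod_Basis_cart) simp
  then show ?thesis
    by (auto simp: unit_cube_eq_box emeasure_lborel_box_eq Basis_vec_def inner_axis)
qed

lemma space_unif: "space unif = unit_cube"
  by (simp add: unif_def space_restrict_space)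

text \<open>As \<^const>\<open>unif\<close> lives on the cube, its measurable sets are the Borel subsets of the cube;
  this is what makes values of a function outside the cube irrelevant for measurability.\<close>
lemma sets_unif: "sets unif = sets (restrict_space borel unit_cube)"
  by (simp add: unif_def sets_restrict_space)

lemma sets_unif_iff: "A \<in> sets unif \<longleftrightarrow> A \<in> sets borel \<and> A \<subseteq> unit_cube"
  unfolding sets_unif using sets_restrict_space_iff[of unit_cube borel A] by auto

lemma emeasure_unif:
  assumes "A \<in> sets unif" shows "emeasure unif A = emeasure lborel A"
proof -
  have A: "A \<in> sets borel" "A \<subseteq> unit_cube" using assms by (auto simp: sets_unif_iff)
  then have "emeasure unif A = emeasure (uniform_measure lborel unit_cube) A"
    unfolding unif_def by (intro emeasure_restrict_space) auto
  also have "\<dots> = emeasure lborel (unit_cube \<inter> A)"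
    using A by (subst emeasure_uniform_measure) (auto simp: emeasure_lborel_unit_cube divide_ennreal_def)
  also have "unit_cube \<inter> A = A" using A by auto
  finally show ?thesis .
qed

lemma unif_eq_restrict_lborel: "unif = restrict_space lborel unit_cube"
  by (rule measure_eqI)
     (auto simp: emeasure_unif sets_unif sets_unif_iff emeasure_restrict_space
        cong: sets_restrict_space_cong dest: sets.sets_into_space)

lemma prob_space_unif: "prob_space (unif :: (real ^ 'n::finite) measure)"
  by (rule prob_spaceI) (simp add: emeasure_unif space_unif emeasure_lborel_unit_cube sets_unif_iff)

interpretation unif: prob_space "unif :: (real ^ 'n::finite) measure"
  by (rule prob_space_unif)

interpretation vz: pair_prob_space "unif :: (real ^ 'n::finite) measure" "unif :: (real ^ 'n::finite) measure" ..

lemma prob_space_vz: "prob_space (vz_space :: ((real ^ 'n::finite) \<times> (real ^ 'n)) measure)"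
  unfolding vz_space_def by unfold_locales

lemma space_vz: "space vz_space = unit_cube \<times> unit_cube"
  by (simp add: vz_space_def space_pair_measure space_unif)

lemma measurable_unif_iff: "g \<in> measurable M unif \<longleftrightarrow> g \<in> borel_measurable M \<and> g \<in> space M \<rightarrow> unit_cube"
proof -
  have "measurable M unif = measurable M (restrict_space borel unit_cube)"
    by (rule measurable_cong_sets) (auto simp: sets_unif)
  then show ?thesis by (auto simp: measurable_restrict_space2_iff)
qed

section \<open>Exchanging coordinates of two independent points\<close>

lemma mix_component: "mix u v z $ j = (if j \<in> u then v $ j else z $ j)"
  by (simp add: mix_def)

lemma mix_UNIV [simp]: "mix UNIV x z = x" and mix_empty [simp]: "mix {} x z = z"
  by (simp_all add: vec_eq_iff mix_component)

lemma mix_Compl: "mix (- u) x z = mix u z x"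
  by (simp add: vec_eq_iff mix_component)

lemma mix_in_unit_cube: "v \<in> unit_cube \<Longrightarrow> z \<in> unit_cube \<Longrightarrow> mix u v z \<in> unit_cube"
  by (simp add: unit_cube_def mix_component)

text \<open>Exchanging the coordinates outside \<open>u\<close> between two points is an involution that only permutes the
  \<open>2 d\<close> coordinates of the pair, so it preserves the joint law of two independent uniform points.
  Together with Fubini's theorem this symmetry yields the integral identities below.\<close>
definition swap_outside :: "'n set \<Rightarrow> (real ^ 'n::finite) \<times> (real ^ 'n) \<Rightarrow> (real ^ 'n) \<times> (real ^ 'n)" where
  "swap_outside u = (\<lambda>(x, z). (mix u x z, mix u z x))"

lemma swap_outside_involution: "swap_outside u (swap_outside u p) = p"
  by (cases p) (auto simp: swap_outside_def vec_eq_iff mix_component)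

lemma continuous_on_mix: "continuous_on UNIV (\<lambda>p :: (real ^ 'n::finite) \<times> (real ^ 'n). mix u (fst p) (snd p))"
  unfolding mix_def
proof (rule continuous_on_vec_lambda)
  show "continuous_on UNIV (\<lambda>p :: (real ^ 'n) \<times> (real ^ 'n). if j \<in> u then fst p $ j else snd p $ j)" for j
    by (cases "j \<in> u") (auto intro!: continuous_intros)
qed

lemma borel_measurable_mix [measurable]:
  assumes [measurable]: "g \<in> borel_measurable M" "h \<in> borel_measurable M"
  shows "(\<lambda>x. mix u (g x) (h x)) \<in> borel_measurable M"
  by (rule borel_measurable_continuous_Pair) (use continuous_on_mix in auto)

lemma borel_measurable_swap_outside [measurable]: "swap_outside u \<in> borel_measurable borel"
  unfolding swap_outside_def case_prod_beta borel_prod[symmetric] by measurable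

text \<open>Lebesgue measure is determined by the volumes of boxes. The preimage of a box under the exchange is
  the box with exchanged corners, and for each index \<open>i\<close> the product of the two side lengths in
  direction \<open>i\<close> is unchanged.\<close>
lemma distr_lborel_swap_outside:
  "distr lborel borel (swap_outside u) = (lborel :: ((real ^ 'n::finite) \<times> (real ^ 'n)) measure)"
proof (rule lborel_eqI[symmetric])
  fix l r :: "(real ^ 'n) \<times> (real ^ 'n)"
  obtain a b c d where lr: "l = (a, b)" "r = (c, d)" by (cases l, cases r) auto
  assume "\<And>b. b \<in> Basis \<Longrightarrow> l \<bullet> b \<le> r \<bullet> b"
  note lr_le = this
  have le: "\<forall>i. a $ i \<le> c $ i" "\<forall>i. b $ i \<le> d $ i"
  proof safe
    fix i
    have "(axis i 1, 0) \<in> (Basis :: ((real ^ 'n) \<times> (real ^ 'n)) set)"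
         "(0, axis i 1) \<in> (Basis :: ((real ^ 'n) \<times> (real ^ 'n)) set)"
      by (auto simp: Basis_prod_def axis_in_Basis_iff)
    from lr_le[OF this(1)] lr_le[OF this(2)] show "a $ i \<le> c $ i" "b $ i \<le> d $ i"
      by (auto simp: lr inner_axis)
  qed
  have box_Times: "box (a, b) (c, d) = box a c \<times> box b d" for a b c d :: "real ^ 'n"
    by (auto simp: box_def Basis_prod_def ball_Un)
  have vol: "emeasure lborel (box (a, b) (c, d)) = (\<Prod>i\<in>UNIV. (c $ i - a $ i) * (d $ i - b $ i))"
    if "\<forall>i. a $ i \<le> c $ i" "\<forall>i. b $ i \<le> d $ i" for a b c d :: "real ^ 'n"
  proof -
    have "emeasure lborel (box a c) = ennreal (\<Prod>i\<in>UNIV. c $ i - a $ i)"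
       "emeasure lborel (box b d) = ennreal (\<Prod>i\<in>UNIV. d $ i - b $ i)"
      using that prod_Basis_cart[of "c - a"] prod_Basis_cart[of "d - b"]
      by (simp_all add: emeasure_lborel_box_eq) (auto simp: Basis_vec_def inner_axis)
    then show ?thesis
      using that unfolding lborel_prod[symmetric] box_Times
      by (simp add: lborel.emeasure_pair_measure_Times prod.distrib ennreal_mult' prod_nonneg)
  qed
  have pre: "swap_outside u -` box l r = box (mix u a b, mix u b a) (mix u c d, mix u d c)"
    unfolding lr box_Times
    by (auto simp: swap_outside_def mem_box_cart mix_component split: if_splits)
  have "emeasure (distr lborel borel (swap_outside u)) (box l r) =
     (\<Prod>i\<in>UNIV. (mix u c d $ i - mix u a b $ i) * (mix u d c $ i - mix u b a $ i))"
    using le by (simp add: emeasure_distr pre vol mix_component)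
  also have "\<dots> = (\<Prod>i\<in>UNIV. (c $ i - a $ i) * (d $ i - b $ i))"
    by (intro arg_cong[where f = ennreal] prod.cong) (auto simp: mix_component)
  also have "\<dots> = emeasure lborel (box l r)" by (simp add: lr vol le)
  also have "\<dots> = ennreal (\<Prod>b\<in>Basis. (r - l) \<bullet> b)"
    using lr_le by simp
  finally show "emeasure (distr lborel borel (swap_outside u)) (box l r) = ennreal (\<Prod>b\<in>Basis. (r - l) \<bullet> b)" .
qed simp

text \<open>The identity is measurable from the product of the cubes with its Borel sets to the product of the
  two restricted spaces, since both of its components are. Its preimages are the sets themselves.\<close>
lemma borel_if_sets_vz:
  assumes "X \<in> sets (vz_space :: ((real ^ 'n::finite) \<times> (real ^ 'n)) measure)"
  shows "X \<in> sets borel"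
proof -
  let ?Q = "unit_cube \<times> unit_cube :: ((real ^ 'n) \<times> (real ^ 'n)) set"
  have Q: "?Q \<in> sets borel"
    unfolding borel_prod[symmetric] by (intro pair_measureI unit_cube_borel)
  have "(\<lambda>p. p) \<in> measurable (restrict_space borel ?Q) vz_space"
    unfolding vz_space_def measurable_pair_iff comp_def measurable_unif_iff
    by (auto simp: space_restrict_space borel_prod[symmetric] intro!: measurable_restrict_space1)
  from measurable_sets[OF this assms] have "X \<inter> ?Q \<in> sets (restrict_space borel ?Q)"
    by (simp add: space_restrict_space)
  moreover have "X \<inter> ?Q = X" using sets.sets_into_space[OF assms] by (auto simp: space_vz)
  ultimately show ?thesis using Q sets_restrict_space_iff[of ?Q borel X] by auto
qed

lemma emeasure_vz:
  assumes X: "X \<in> sets (vz_space :: ((real ^ 'n::finite) \<times> (real ^ 'n)) measure)"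
  shows "emeasure vz_space X = emeasure lborel X"
proof -
  have "emeasure vz_space X = (\<integral>\<^sup>+x. emeasure unif (Pair x -` X) \<partial>unif)"
    by (rule unif.emeasure_pair_measure_alt[OF X[unfolded vz_space_def], folded vz_space_def])
  also have "\<dots> = (\<integral>\<^sup>+x. emeasure lborel (Pair x -` X) \<partial>restrict_space lborel unit_cube)"
    unfolding unif_eq_restrict_lborel[symmetric]
    by (intro nn_integral_cong emeasure_unif sets_Pair1[OF X[unfolded vz_space_def]])
  also have "\<dots> = (\<integral>\<^sup>+x. emeasure lborel (Pair x -` X) * indicator unit_cube x \<partial>lborel)"
    by (rule nn_integral_restrict_space) simp
  also have "\<dots> = (\<integral>\<^sup>+x. emeasure lborel (Pair x -` X) \<partial>lborel)"
  proof (intro nn_integral_cong)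
    fix x :: "real ^ 'n"
    have "Pair x -` X = {}" if "x \<notin> unit_cube"
      using that sets.sets_into_space[OF X] by (auto simp: space_vz)
    then show "emeasure lborel (Pair x -` X) * indicator unit_cube x = emeasure lborel (Pair x -` X)"
      by (cases "x \<in> unit_cube") auto
  qed
  also have "\<dots> = emeasure lborel X"
    using borel_if_sets_vz[OF X] unfolding lborel_prod[symmetric]
    by (intro lborel.emeasure_pair_measure_alt[symmetric])
       (metis borel_prod sets_lborel sets_pair_measure_cong)
  finally show ?thesis .
qed

lemma measurable_swap_outside_vz [measurable]: "swap_outside u \<in> measurable vz_space vz_space"
proof -
  have "fst \<in> borel_measurable vz_space" "snd \<in> borel_measurable vz_space"
    using measurable_fst[of unif unif] measurable_snd[of unif unif] by (auto simp: vz_space_def measurable_unif_iff)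
  note [measurable] = this
  show ?thesis
    unfolding swap_outside_def case_prod_beta
    by (subst (2) vz_space_def, rule measurable_Pair) (auto simp: measurable_unif_iff space_vz mix_in_unit_cube)
qed

lemma distr_vz_swap_outside:
  "distr vz_space vz_space (swap_outside u) = (vz_space :: ((real ^ 'n::finite) \<times> (real ^ 'n)) measure)"
proof (rule measure_eqI)
  fix X :: "((real ^ 'n) \<times> (real ^ 'n)) set"
  assume "X \<in> sets (distr vz_space vz_space (swap_outside u))"
  then have X: "X \<in> sets vz_space" by simp
  have sub: "X \<subseteq> unit_cube \<times> unit_cube" using sets.sets_into_space[OF X] by (auto simp: space_vz)
  have pre: "swap_outside u -` X \<inter> space vz_space = swap_outside u -` X"
  proof -
    have "p \<in> unit_cube \<times> unit_cube" if "swap_outside u p \<in> X" for p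
    proof -
      have "swap_outside u (swap_outside u p) \<in> unit_cube \<times> unit_cube"
        using that sub by (cases "swap_outside u p") (auto simp: swap_outside_def intro!: mix_in_unit_cube)
      then show ?thesis by (simp add: swap_outside_involution)
    qed
    then show ?thesis unfolding space_vz by blast
  qed
  have "emeasure (distr vz_space vz_space (swap_outside u)) X = emeasure lborel (swap_outside u -` X)"
    using measurable_sets[OF measurable_swap_outside_vz X, of u]
    by (simp add: emeasure_distr X pre emeasure_vz)
  also have "\<dots> = emeasure (distr lborel borel (swap_outside u)) X"
    using borel_if_sets_vz[OF X] by (simp add: emeasure_distr)
  also have "\<dots> = emeasure vz_space X" by (simp add: distr_lborel_swap_outside emeasure_vz X)
  finally show "emeasure (distr vz_space vz_space (swap_outside u)) X = emeasure vz_space X" .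
qed simp

lemma measurable_mix_vz: "(\<lambda>(x, z). mix u x z) \<in> measurable vz_space unif"
  using measurable_comp[OF measurable_swap_outside_vz[of u], of fst unif]
  by (auto simp: swap_outside_def comp_def case_prod_unfold vz_space_def)

lemma measurable_mix_vz_compose:
  assumes "f \<in> borel_measurable unif"
  shows "(\<lambda>(x, z). f (mix u x z)) \<in> borel_measurable vz_space"
  using measurable_comp[OF measurable_mix_vz[of u] assms] by (simp add: comp_def case_prod_unfold)

lemma integral_vz_swap_outside:
  fixes g :: "(real ^ 'n::finite) \<times> (real ^ 'n) \<Rightarrow> real"
  assumes "g \<in> borel_measurable vz_space"
  shows "(\<integral>p. g (swap_outside u p) \<partial>vz_space) = (\<integral>p. g p \<partial>vz_space)"
  using integral_distr[OF measurable_swap_outside_vz assms, of u] by (simp add: distr_vz_swap_outside)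

section \<open>Bounded measurable functions on the cube\<close>

definition bounded_measurable :: "(real ^ 'n::finite \<Rightarrow> real) \<Rightarrow> bool" where
  "bounded_measurable f \<longleftrightarrow> f \<in> borel_measurable unif \<and> bounded (f ` unit_cube)"

lemma bounded_measurableE:
  assumes "bounded_measurable f"
  obtains B where "f \<in> borel_measurable unif" "\<And>x. x \<in> unit_cube \<Longrightarrow> \<bar>f x\<bar> \<le> B" "B \<ge> 0"
proof -
  obtain B where "\<And>x. x \<in> unit_cube \<Longrightarrow> \<bar>f x\<bar> \<le> B"
    using assms by (auto simp: bounded_measurable_def bounded_iff)
  then have "\<And>x. x \<in> unit_cube \<Longrightarrow> \<bar>f x\<bar> \<le> max B 0" by (simp add: le_max_iff_disj)
  then show ?thesis using that[of "max B 0"] assms by (auto simp: bounded_measurable_def)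
qed

lemma bounded_measurableI:
  "f \<in> borel_measurable unif \<Longrightarrow> (\<And>x. x \<in> unit_cube \<Longrightarrow> \<bar>f x\<bar> \<le> B) \<Longrightarrow> bounded_measurable f"
  by (auto simp: bounded_measurable_def bounded_iff)

lemma bounded_measurable_const: "bounded_measurable (\<lambda>_. c)"
  by (rule bounded_measurableI[of _ "\<bar>c\<bar>"]) auto

lemma bounded_measurable_diff:
  assumes "bounded_measurable f" "bounded_measurable g"
  shows "bounded_measurable (\<lambda>x. f x - g x)"
proof -
  obtain A where A: "f \<in> borel_measurable unif" "\<And>x. x \<in> unit_cube \<Longrightarrow> \<bar>f x\<bar> \<le> A" "A \<ge> 0"
    by (rule bounded_measurableE[OF assms(1)]) (rule that)
  obtain B where B: "g \<in> borel_measurable unif" "\<And>x. x \<in> unit_cube \<Longrightarrow> \<bar>g x\<bar> \<le> B" "B \<ge> 0"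
    by (rule bounded_measurableE[OF assms(2)]) (rule that)
  have "\<bar>f x - g x\<bar> \<le> A + B" if "x \<in> unit_cube" for x
    using A(2)[OF that] B(2)[OF that] by linarith
  then show ?thesis by (rule bounded_measurableI[rotated]) (use A(1) B(1) in auto)
qed

lemma bounded_measurable_mult:
  assumes "bounded_measurable f" "bounded_measurable g"
  shows "bounded_measurable (\<lambda>x. f x * g x)"
proof -
  obtain A where A: "f \<in> borel_measurable unif" "\<And>x. x \<in> unit_cube \<Longrightarrow> \<bar>f x\<bar> \<le> A" "A \<ge> 0"
    by (rule bounded_measurableE[OF assms(1)]) (rule that)
  obtain B where B: "g \<in> borel_measurable unif" "\<And>x. x \<in> unit_cube \<Longrightarrow> \<bar>g x\<bar> \<le> B" "B \<ge> 0"
    by (rule bounded_measurableE[OF assms(2)]) (rule that)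
  have "\<bar>f x * g x\<bar> \<le> A * B" if "x \<in> unit_cube" for x
    unfolding abs_mult using A(2)[OF that] B(2)[OF that] A(3) by (intro mult_mono) auto
  then show ?thesis by (rule bounded_measurableI[rotated]) (use A(1) B(1) in auto)
qed

lemma bounded_measurable_sum:
  assumes "\<And>i. i \<in> I \<Longrightarrow> bounded_measurable (f i)"
  shows "bounded_measurable (\<lambda>x. \<Sum>i\<in>I. f i x)"
proof -
  have "\<forall>i\<in>I. \<exists>B. \<forall>x\<in>unit_cube. \<bar>f i x\<bar> \<le> B"
    using assms by (auto simp: bounded_measurable_def bounded_iff)
  then obtain B where B: "\<And>i x. i \<in> I \<Longrightarrow> x \<in> unit_cube \<Longrightarrow> \<bar>f i x\<bar> \<le> B i"
    unfolding bchoice_iff by blast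
  show ?thesis
  proof (rule bounded_measurableI)
    show "(\<lambda>x. \<Sum>i\<in>I. f i x) \<in> borel_measurable unif"
      using assms by (intro borel_measurable_sum) (auto simp: bounded_measurable_def)
    show "\<bar>\<Sum>i\<in>I. f i x\<bar> \<le> (\<Sum>i\<in>I. B i)" if "x \<in> unit_cube" for x
      by (rule order_trans[OF sum_abs]) (intro sum_mono B that)
  qed
qed

lemma integrable_if_bounded_measurable:
  assumes "bounded_measurable f" shows "integrable unif f"
proof -
  obtain B where "f \<in> borel_measurable unif" "\<And>x. x \<in> unit_cube \<Longrightarrow> \<bar>f x\<bar> \<le> B" "B \<ge> 0"
    by (rule bounded_measurableE[OF assms]) (rule that)
  then show ?thesis
    by (intro unif.integrable_const_bound[of _ B]) (auto simp: space_unif)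
qed

lemma bounded_measurable_mix_bound:
  assumes "bounded_measurable f"
  obtains B where "(\<lambda>(x, z). f (mix u x z)) \<in> borel_measurable vz_space"
    "\<And>x z. x \<in> unit_cube \<Longrightarrow> z \<in> unit_cube \<Longrightarrow> \<bar>f (mix u x z)\<bar> \<le> B" "B \<ge> 0"
  using bounded_measurableE[OF assms] by (metis mix_in_unit_cube measurable_mix_vz_compose)

lemma integrable_vz_mix_mult:
  assumes "bounded_measurable f" "bounded_measurable g"
  shows "integrable vz_space (\<lambda>(x, z). f (mix u x z) * g (mix w x z))"
proof -
  interpret V: prob_space "vz_space :: ((real ^ 'a) \<times> (real ^ 'a)) measure" by (rule prob_space_vz)
  obtain A where A: "(\<lambda>(x, z). f (mix u x z)) \<in> borel_measurable vz_space"
    "\<And>x z. x \<in> unit_cube \<Longrightarrow> z \<in> unit_cube \<Longrightarrow> \<bar>f (mix u x z)\<bar> \<le> A" "A \<ge> 0"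
    by (rule bounded_measurable_mix_bound[OF assms(1)]) (rule that)
  obtain B where B: "(\<lambda>(x, z). g (mix w x z)) \<in> borel_measurable vz_space"
    "\<And>x z. x \<in> unit_cube \<Longrightarrow> z \<in> unit_cube \<Longrightarrow> \<bar>g (mix w x z)\<bar> \<le> B" "B \<ge> 0"
    by (rule bounded_measurable_mix_bound[OF assms(2)]) (rule that)
  show ?thesis
  proof (rule V.integrable_const_bound[of _ "A * B"])
    show "AE p in vz_space. norm ((\<lambda>(x, z). f (mix u x z) * g (mix w x z)) p) \<le> A * B"
      using A(2,3) B(2) by (intro AE_I2) (auto simp: space_vz abs_mult intro!: mult_mono)
    show "(\<lambda>(x, z). f (mix u x z) * g (mix w x z)) \<in> borel_measurable vz_space"
      using borel_measurable_times[OF A(1) B(1)] by (simp add: case_prod_unfold)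
  qed
qed

lemma integrable_vz_mix:
  assumes "bounded_measurable f"
  shows "integrable vz_space (\<lambda>(x, z). f (mix u x z))"
  using integrable_vz_mix_mult[OF assms bounded_measurable_const[of 1]] by simp

lemma integral_vz_fst:
  fixes g :: "real ^ 'n::finite \<Rightarrow> real"
  assumes "bounded_measurable g"
  shows "(\<integral>p. g (fst p) \<partial>vz_space) = (\<integral>x. g x \<partial>unif)"
proof -
  have "integrable (unif \<Otimes>\<^sub>M (unif :: (real ^ 'n) measure)) (\<lambda>(x, z). g x)"
    using integrable_vz_mix[OF assms, of UNIV] by (simp add: vz_space_def)
  from vz.integral_fst'[OF this] show ?thesis
    by (simp add: vz_space_def case_prod_unfold unif.prob_space)
qed

text \<open>A point whose coordinates are taken partly from one and partly from another independent uniform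
  point is again uniform: it is the first component of the exchanged pair.\<close>
lemma integral_vz_mix:
  fixes g :: "real ^ 'n::finite \<Rightarrow> real"
  assumes "bounded_measurable g"
  shows "(\<integral>p. g (mix u (fst p) (snd p)) \<partial>vz_space) = (\<integral>x. g x \<partial>unif)"
proof -
  have "(\<lambda>p. g (fst p)) \<in> borel_measurable vz_space"
    using integrable_vz_mix[OF assms, of UNIV] by (auto simp: case_prod_unfold)
  from integral_vz_swap_outside[OF this, of u] show ?thesis
    using integral_vz_fst[OF assms] by (simp add: swap_outside_def case_prod_unfold)
qed

section \<open>Averaging over the coordinates outside a set\<close>

text \<open>In probabilistic terms \<open>cond_mean u f\<close> is the conditional expectation of \<open>f\<close> given the coordinates
  in \<open>u\<close>; these operators are commuting orthogonal projections in \<open>L\<^sup>2\<close>.\<close>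
definition cond_mean :: "'n set \<Rightarrow> (real ^ 'n::finite \<Rightarrow> real) \<Rightarrow> real ^ 'n \<Rightarrow> real" where
  "cond_mean u f x = (\<integral>z. f (mix u x z) \<partial>unif)"

definition unif_inner :: "(real ^ 'n::finite \<Rightarrow> real) \<Rightarrow> (real ^ 'n \<Rightarrow> real) \<Rightarrow> real" where
  "unif_inner f g = (\<integral>x. f x * g x \<partial>unif)"

lemma bounded_measurable_mix_right:
  assumes f: "bounded_measurable f" and x: "x \<in> unit_cube"
  shows "bounded_measurable (\<lambda>z. f (mix u x z))"
proof -
  obtain B where B: "(\<lambda>(x, z). f (mix u x z)) \<in> borel_measurable vz_space"
    "\<And>x z. x \<in> unit_cube \<Longrightarrow> z \<in> unit_cube \<Longrightarrow> \<bar>f (mix u x z)\<bar> \<le> B" "B \<ge> 0"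
    by (rule bounded_measurable_mix_bound[OF assms(1)]) (rule that)
  have "(\<lambda>z. (x, z)) \<in> measurable unif vz_space"
    unfolding vz_space_def using x by (intro measurable_Pair1') (simp add: space_unif)
  from measurable_comp[OF this B(1)] show ?thesis
    using B(2)[OF x] by (intro bounded_measurableI) (auto simp: comp_def)
qed

lemma bounded_measurable_cond_mean:
  assumes f: "bounded_measurable f"
  shows "bounded_measurable (cond_mean u f)"
proof -
  obtain B where B: "(\<lambda>(x, z). f (mix u x z)) \<in> borel_measurable vz_space"
    "\<And>x z. x \<in> unit_cube \<Longrightarrow> z \<in> unit_cube \<Longrightarrow> \<bar>f (mix u x z)\<bar> \<le> B" "B \<ge> 0"
    by (rule bounded_measurable_mix_bound[OF assms(1)]) (rule that)
  show ?thesis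
  proof (rule bounded_measurableI)
    show "cond_mean u f \<in> borel_measurable unif"
      using B(1) unfolding cond_mean_def[abs_def] vz_space_def
      by (intro unif.borel_measurable_lebesgue_integral) auto
    fix x :: "real ^ 'a" assume x: "x \<in> unit_cube"
    have "\<bar>cond_mean u f x\<bar> \<le> (\<integral>z. \<bar>f (mix u x z)\<bar> \<partial>unif)"
      unfolding cond_mean_def by (rule integral_abs_bound)
    also have "\<dots> \<le> B"
      using B(2)[OF x] integrable_if_bounded_measurable[OF bounded_measurable_mix_right[OF f x]]
      by (intro unif.integral_le_const) (auto simp: space_unif)
    finally show "\<bar>cond_mean u f x\<bar> \<le> B" .
  qed
qed

lemma unif_inner_cond_mean_left:
  assumes f: "bounded_measurable f" and g: "bounded_measurable g"
  shows "unif_inner (cond_mean u f) g = (\<integral>(x, z). f (mix u x z) * g x \<partial>vz_space)"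
proof -
  have "integrable (unif \<Otimes>\<^sub>M unif) (\<lambda>(x, z). f (mix u x z) * g x)"
    using integrable_vz_mix_mult[OF f g, of u UNIV] by (simp add: vz_space_def)
  from vz.integral_fst'[OF this] show ?thesis
    by (simp add: vz_space_def case_prod_unfold unif_inner_def cond_mean_def)
qed

text \<open>The left side integrates \<open>f x' g x\<close> with \<open>x' = mix u x z\<close>. The exchange carries \<open>(x, z)\<close> to
  \<open>(x', z')\<close> and, being an involution, recovers \<open>x = mix u x' z'\<close>; so in the exchanged variables the
  same integral is the right side.\<close>
lemma cond_mean_self_adjoint:
  assumes f: "bounded_measurable f" and g: "bounded_measurable g"
  shows "unif_inner (cond_mean u f) g = unif_inner f (cond_mean u g)"
proof -
  let ?h = "\<lambda>(x, z). f (mix u x z) * g x"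
  have "?h \<in> borel_measurable vz_space"
    using integrable_vz_mix_mult[OF f g, of u UNIV] by auto
  from integral_vz_swap_outside[OF this, of u]
  have "(\<integral>p. ?h p \<partial>vz_space) = (\<integral>p. ?h (swap_outside u p) \<partial>vz_space)" by simp
  also have "\<dots> = (\<integral>(x, z). g (mix u x z) * f x \<partial>vz_space)"
  proof (intro Bochner_Integration.integral_cong refl)
    fix p :: "(real ^ 'a) \<times> (real ^ 'a)"
    obtain x z where p: "p = (x, z)" by (cases p)
    have "mix u (mix u x z) (mix u z x) = x" by (simp add: vec_eq_iff mix_component)
    then show "?h (swap_outside u p) = (\<lambda>(x, z). g (mix u x z) * f x) p"
      by (simp add: p swap_outside_def)
  qed
  also have "\<dots> = unif_inner (cond_mean u g) f" by (rule unif_inner_cond_mean_left[OF g f, symmetric])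
  finally show ?thesis using unif_inner_cond_mean_left[OF f g, of u]
    by (simp add: unif_inner_def mult.commute)
qed

text \<open>The iterated average evaluates \<open>f\<close> at a point that has the coordinates of \<open>x\<close> in \<open>u \<inter> v\<close> and
  elsewhere those of \<open>mix v z w\<close>, which is uniform.\<close>
lemma cond_mean_cond_mean:
  assumes f: "bounded_measurable f" and x: "x \<in> unit_cube"
  shows "cond_mean u (cond_mean v f) x = cond_mean (u \<inter> v) f x"
proof -
  let ?F = "\<lambda>y. f (mix (u \<inter> v) x y)"
  have F: "bounded_measurable ?F" by (rule bounded_measurable_mix_right[OF f x])
  have eq: "mix v (mix u x z) w = mix (u \<inter> v) x (mix v z w)" for z w :: "real ^ 'a"
    by (simp add: vec_eq_iff mix_component)
  have "integrable (unif \<Otimes>\<^sub>M unif) (\<lambda>(z, w). ?F (mix v z w))"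
    using integrable_vz_mix[OF F] by (simp add: vz_space_def)
  from vz.integral_fst'[OF this]
  have "cond_mean u (cond_mean v f) x = (\<integral>(z, w). ?F (mix v z w) \<partial>vz_space)"
    by (simp add: cond_mean_def eq vz_space_def)
  also have "\<dots> = cond_mean (u \<inter> v) f x"
    using integral_vz_mix[OF F, of v] by (simp add: cond_mean_def case_prod_unfold)
  finally show ?thesis .
qed

lemma unif_inner_commute: "unif_inner f g = unif_inner g f"
  by (simp add: unif_inner_def mult.commute)

lemma unif_inner_cong:
  "(\<And>x. x \<in> unit_cube \<Longrightarrow> f x = f' x) \<Longrightarrow> (\<And>x. x \<in> unit_cube \<Longrightarrow> g x = g' x) \<Longrightarrow>
   unif_inner f g = unif_inner f' g'"
  unfolding unif_inner_def by (intro Bochner_Integration.integral_cong) (auto simp: space_unif)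

text \<open>Self-adjointness moves one average to the other side, where the two compose to a single one. So the
  inner product depends on \<open>u \<inter> v\<close> only, from which the orthogonality of the components will follow.\<close>
lemma unif_inner_cond_mean_cond_mean:
  assumes f: "bounded_measurable f"
  shows "unif_inner (cond_mean u f) (cond_mean v f) = unif_inner f (cond_mean (u \<inter> v) f)"
  using cond_mean_self_adjoint[OF f bounded_measurable_cond_mean[OF f], of u v]
     unif_inner_cong[of f f "cond_mean u (cond_mean v f)" "cond_mean (u \<inter> v) f"]
  by (simp add: cond_mean_cond_mean[OF f])

section \<open>Orthogonality of the ANOVA components\<close>

lemma cond_mean_eq_sum_anova: "cond_mean u f x = (\<Sum>v\<in>Pow u. anova f v x)"
proof -
  have "Pow u = insert u {v. v \<subset> u}" by auto
  then show ?thesis by (simp add: cond_mean_def anova.simps[of f u x])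
qed

lemma anova_eq_diff: "anova f u = (\<lambda>x. cond_mean u f x - (\<Sum>v | v \<subset> u. anova f v x))"
  by (rule ext) (simp add: anova.simps[of f u] cond_mean_def)

lemma bounded_measurable_anova:
  assumes f: "bounded_measurable f" shows "bounded_measurable (anova f u)"
proof (induction "card u" arbitrary: u rule: less_induct)
  case less
  have "bounded_measurable (anova f v)" if "v \<subset> u" for v
    using less[of v] that by (simp add: psubset_card_mono)
  then show ?case
    unfolding anova_eq_diff[of f u]
    by (intro bounded_measurable_diff bounded_measurable_sum bounded_measurable_cond_mean f) auto
qed

lemma unif_inner_diff_left:
  assumes "bounded_measurable f" "bounded_measurable g" "bounded_measurable h"
  shows "unif_inner (\<lambda>x. f x - g x) h = unif_inner f h - unif_inner g h"
  using assms unfolding unif_inner_def left_diff_distrib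
  by (intro Bochner_Integration.integral_diff integrable_if_bounded_measurable bounded_measurable_mult)

lemma unif_inner_sum_left:
  assumes "\<And>i. i \<in> I \<Longrightarrow> bounded_measurable (f i)" "bounded_measurable h"
  shows "unif_inner (\<lambda>x. \<Sum>i\<in>I. f i x) h = (\<Sum>i\<in>I. unif_inner (f i) h)"
  using assms unfolding unif_inner_def sum_distrib_right
  by (intro Bochner_Integration.integral_sum integrable_if_bounded_measurable bounded_measurable_mult)

lemma unif_inner_cond_mean_sum:
  assumes f: "bounded_measurable f" and g: "bounded_measurable g"
  shows "unif_inner (cond_mean u f) g = (\<Sum>v\<in>Pow u. unif_inner (anova f v) g)"
  unfolding cond_mean_eq_sum_anova[abs_def]
  by (intro unif_inner_sum_left bounded_measurable_anova f g)

text \<open>Induction on \<open>u\<close>. Of the components subtracted in the definition of \<open>anova f u\<close> only those with index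
  set inside \<open>u \<inter> w\<close> survive the inner product with \<open>cond_mean w f\<close>. They add up to the average over
  \<open>u \<inter> w\<close>, whose inner product with \<open>cond_mean w f\<close> is the same as that of \<open>cond_mean u f\<close>.\<close>
lemma anova_orthogonal_cond_mean:
  assumes f: "bounded_measurable f" and "\<not> u \<subseteq> w"
  shows "unif_inner (anova f u) (cond_mean w f) = 0"
  using assms(2)
proof (induction "card u" arbitrary: u rule: less_induct)
  case less
  note bm = bounded_measurable_anova[OF f] bounded_measurable_cond_mean[OF f]
  have "unif_inner (anova f u) (cond_mean w f) =
     unif_inner (cond_mean u f) (cond_mean w f) - (\<Sum>v | v \<subset> u. unif_inner (anova f v) (cond_mean w f))"
    by (subst anova_eq_diff)
       (simp add: unif_inner_diff_left unif_inner_sum_left bm bounded_measurable_sum)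
  also have "(\<Sum>v | v \<subset> u. unif_inner (anova f v) (cond_mean w f)) =
      (\<Sum>v\<in>Pow (u \<inter> w). unif_inner (anova f v) (cond_mean w f))"
  proof (rule sum.mono_neutral_right)
    show "Pow (u \<inter> w) \<subseteq> {v. v \<subset> u}" using less.prems by auto
    have "unif_inner (anova f v) (cond_mean w f) = 0" if "v \<subset> u" "\<not> v \<subseteq> w" for v
      using less.hyps[of v] that by (simp add: psubset_card_mono)
    then show "\<forall>v\<in>{v. v \<subset> u} - Pow (u \<inter> w). unif_inner (anova f v) (cond_mean w f) = 0"
      by blast
  qed simp
  also have "\<dots> = unif_inner (cond_mean (u \<inter> w) f) (cond_mean w f)"
    by (rule unif_inner_cond_mean_sum[symmetric]) (use f bm in auto)
  finally show ?case
    by (simp add: unif_inner_cond_mean_cond_mean[OF f] Int_assoc)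
qed

text \<open>Induction on \<open>v\<close>: the average over \<open>v\<close> is orthogonal to \<open>anova f u\<close> by the previous lemma, and the
  components subtracted from it have index sets that do not contain \<open>u\<close> either.\<close>
lemma anova_orthogonal_if_not_subset:
  assumes f: "bounded_measurable f" and "\<not> u \<subseteq> v"
  shows "unif_inner (anova f u) (anova f v) = 0"
  using assms(2)
proof (induction "card v" arbitrary: v rule: less_induct)
  case less
  note bm = bounded_measurable_anova[OF f] bounded_measurable_cond_mean[OF f]
  have "unif_inner (anova f w) (anova f u) = 0" if "w \<subset> v" for w
    using less.hyps[of w] less.prems that by (auto simp: psubset_card_mono unif_inner_commute)
  moreover have "unif_inner (anova f v) (anova f u) =
     unif_inner (cond_mean v f) (anova f u) - (\<Sum>w | w \<subset> v. unif_inner (anova f w) (anova f u))"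
    by (subst anova_eq_diff)
       (simp add: unif_inner_diff_left unif_inner_sum_left bm bounded_measurable_sum)
  ultimately show ?case
    using anova_orthogonal_cond_mean[OF f less.prems] by (simp add: unif_inner_commute)
qed

lemma anova_orthogonal:
  assumes "bounded_measurable f" and "u \<noteq> v"
  shows "unif_inner (anova f u) (anova f v) = 0"
proof (cases "u \<subseteq> v")
  case True
  then have "\<not> v \<subseteq> u" using assms by auto
  then show ?thesis using anova_orthogonal_if_not_subset[OF assms(1), of v u] by (simp add: unif_inner_commute)
qed (use anova_orthogonal_if_not_subset[OF assms(1)] in auto)

text \<open>Since averaging is an orthogonal projection, the left side is the squared norm of \<open>cond_mean u f\<close>.
  This form without squares is the one that arises when the square of a difference is expanded.\<close>
lemma anova_pythagoras:
  assumes f: "bounded_measurable f"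
  shows "unif_inner f (cond_mean u f) = (\<Sum>v\<in>Pow u. unif_inner (anova f v) (anova f v))"
proof -
  note bm = bounded_measurable_anova[OF f] bounded_measurable_cond_mean[OF f]
  have "unif_inner f (cond_mean u f) = unif_inner (cond_mean u f) (cond_mean u f)"
    by (simp add: unif_inner_cond_mean_cond_mean[OF f])
  also have "\<dots> = (\<Sum>v\<in>Pow u. unif_inner (anova f v) (cond_mean u f))"
    by (intro unif_inner_cond_mean_sum f bm)
  also have "\<dots> = (\<Sum>v\<in>Pow u. unif_inner (anova f v) (anova f v))"
  proof (rule sum.cong[OF refl])
    fix v assume "v \<in> Pow u"
    have "unif_inner (cond_mean u f) (anova f v) = (\<Sum>w\<in>Pow u. unif_inner (anova f w) (anova f v))"
      by (intro unif_inner_cond_mean_sum f bm)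
    also have "\<dots> = (\<Sum>w\<in>{v}. unif_inner (anova f w) (anova f v))"
      using \<open>v \<in> Pow u\<close> anova_orthogonal[OF f] by (intro sum.mono_neutral_right) auto
    finally show "unif_inner (anova f v) (cond_mean u f) = unif_inner (anova f v) (anova f v)"
      by (simp add: unif_inner_commute)
  qed
  finally show ?thesis .
qed

section \<open>The formula of Sobol'\<close>

text \<open>By Pythagoras for all coordinates and for all coordinates except \<open>i\<close>, the sum is
  \<open>unif_inner f f - unif_inner f (cond_mean (- {i}) f)\<close>. Expanding the square on the right gives twice
  this: both arguments of \<open>f\<close> are uniform, and the mixed term is the inner product of \<open>f\<close> with its
  average over the \<open>i\<close>th coordinate.\<close>
lemma sum_anova_sq_eq:
  assumes f: "bounded_measurable f"
  shows "(\<Sum>u | i \<in> u. unif_inner (anova f u) (anova f u)) =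
     1 / 2 * (\<integral>(v, z). (f (mix {i} v z) - f z)\<^sup>2 \<partial>vz_space)"
proof -
  let ?a = "\<lambda>u. unif_inner (anova f u) (anova f u)"
  have "cond_mean UNIV f = f" by (simp add: cond_mean_def fun_eq_iff unif.prob_space)
  then have total: "unif_inner f f = (\<Sum>u\<in>UNIV. ?a u)"
    using anova_pythagoras[OF f, of UNIV] by simp
  have "(\<Sum>u\<in>UNIV. ?a u) = (\<Sum>u\<in>{u. i \<in> u} \<union> Pow (- {i}). ?a u)"
    by (rule sum.cong) auto
  also have "\<dots> = (\<Sum>u | i \<in> u. ?a u) + (\<Sum>u\<in>Pow (- {i}). ?a u)"
    by (rule sum.union_disjoint) auto
  finally have split: "(\<Sum>u\<in>UNIV. ?a u) = (\<Sum>u | i \<in> u. ?a u) + (\<Sum>u\<in>Pow (- {i}). ?a u)" .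
  have lhs: "(\<Sum>u | i \<in> u. ?a u) = unif_inner f f - unif_inner f (cond_mean (- {i}) f)"
    using total split anova_pythagoras[OF f, of "- {i}"] by simp
  let ?g = "\<lambda>p. f (mix {i} (fst p) (snd p))"
  have int: "integrable vz_space (\<lambda>p. ?g p * ?g p)" "integrable vz_space (\<lambda>p. ?g p * f (snd p))"
     "integrable vz_space (\<lambda>p. f (snd p) * f (snd p))"
    using integrable_vz_mix_mult[OF f f, of "{i}" "{i}"] integrable_vz_mix_mult[OF f f, of "{i}" "{}"]
          integrable_vz_mix_mult[OF f f, of "{}" "{}"] by (auto simp: case_prod_unfold)
  have sq: "(\<integral>p. f (mix u (fst p) (snd p)) * f (mix u (fst p) (snd p)) \<partial>vz_space) = unif_inner f f" for u
    using integral_vz_mix[OF bounded_measurable_mult[OF f f]] by (simp add: unif_inner_def)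
  have cross: "(\<integral>p. ?g p * f (snd p) \<partial>vz_space) = unif_inner f (cond_mean (- {i}) f)"
  proof -
    let ?h = "\<lambda>p. f (mix (- {i}) (fst p) (snd p)) * f (fst p)"
    have "?h \<in> borel_measurable vz_space"
      using integrable_vz_mix_mult[OF f f, of "- {i}" UNIV] by (auto simp: case_prod_unfold)
    \<comment> \<open>As \<open>mix {} x z = z\<close>, the empty set gives the interchange of both points: \<open>swap_outside {} (v, z) = (z, v)\<close>.\<close>
    from integral_vz_swap_outside[OF this, of "{}"]
    have "(\<integral>p. ?g p * f (snd p) \<partial>vz_space) = (\<integral>p. ?h p \<partial>vz_space)"
      by (simp add: swap_outside_def case_prod_unfold mix_Compl)
    then show ?thesis
      using unif_inner_cond_mean_left[OF f f, of "- {i}"] by (simp add: unif_inner_commute case_prod_unfold)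
  qed
  have "(\<integral>(v, z). (f (mix {i} v z) - f z)\<^sup>2 \<partial>vz_space) =
     (\<integral>p. ?g p * ?g p - 2 * (?g p * f (snd p)) + f (snd p) * f (snd p) \<partial>vz_space)"
    by (intro Bochner_Integration.integral_cong) (auto simp: power2_eq_square algebra_simps)
  also have "\<dots> = unif_inner f f - 2 * unif_inner f (cond_mean (- {i}) f) + unif_inner f f"
    using int sq[of "{i}"] sq[of "{}"] cross by simp
  finally show ?thesis using lhs by simp
qed

lemma variance_le_second_moment:
  assumes "bounded_measurable g"
  shows "var g \<le> unif_inner g g"
proof -
  have "var g = (\<integral>x. (g x)\<^sup>2 \<partial>unif) - (\<integral>x. g x \<partial>unif)\<^sup>2"
    unfolding var_def using integrable_if_bounded_measurable[OF assms]
       integrable_if_bounded_measurable[OF bounded_measurable_mult[OF assms assms]]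
    by (intro unif.variance_eq) (auto simp: power2_eq_square)
  then show ?thesis by (simp add: unif_inner_def power2_eq_square)
qed

section \<open>The diagonal of the activity matrix\<close>

lemma gas_integrand_nonneg: "0 \<le> gas_integrand f i i p"
  by (cases p) (simp add: gas_integrand_def)

text \<open>The sides of the cube have length one, so \<open>(v\<^sub>i - z\<^sub>i)\<^sup>2 \<le> 1\<close> and dividing by it can
  only increase. Where \<open>v\<^sub>i = z\<^sub>i\<close> the increment itself is zero.\<close>
lemma sq_increment_le_gas_integrand:
  assumes "v \<in> unit_cube" "z \<in> unit_cube"
  shows "(f (mix {i} v z) - f z)\<^sup>2 \<le> gas_integrand f i i (v, z)"
proof (cases "v $ i = z $ i")
  case True
  then have "mix {i} v z = z" by (simp add: vec_eq_iff mix_component)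
  then show ?thesis by (simp add: gas_integrand_def)
next
  case False
  have "\<bar>v $ i - z $ i\<bar> \<le> 1" using assms by (simp add: unit_cube_def abs_le_iff) (smt (verit))
  then have "(v $ i - z $ i)\<^sup>2 \<le> 1" by (simp add: abs_square_le_1)
  with False have "(f (mix {i} v z) - f z)\<^sup>2 \<le> (f (mix {i} v z) - f z)\<^sup>2 / (v $ i - z $ i)\<^sup>2"
    by (simp add: field_simps mult_left_le_one_le)
  then show ?thesis by (simp add: gas_integrand_def gas_D_def power2_eq_square)
qed

text \<open>Taking the expectation undoes the conditioning on \<open>z\<close>.\<close>
lemma C_gas_entry:
  assumes "C_gas_finite f"
  shows "C_gas f $ i $ j = (\<integral>p. gas_integrand f i j p \<partial>vz_space)"
proof -
  interpret V: prob_space "vz_space :: ((real ^ 'a) \<times> (real ^ 'a)) measure" by (rule prob_space_vz)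
  have "subalgebra vz_space (sigma_z :: ((real ^ 'a) \<times> (real ^ 'a)) measure)"
    unfolding subalgebra_def sigma_z_def
    by (simp add: sets_image_in_sets vz_space_def)
  then interpret finite_measure_subalgebra vz_space "sigma_z :: ((real ^ 'a) \<times> (real ^ 'a)) measure"
    by unfold_locales
  show ?thesis using assms real_cond_exp_int(2) by (simp add: C_gas_def C_gas_finite_def)
qed

text \<open>The \<open>i\<close>th diagonal entry of \<open>U \<Lambda> U\<^sup>T\<close> is \<open>\<Sum>\<^sub>j \<lambda>\<^sub>j u\<^sub>i\<^sub>j\<^sup>2\<close>, and the positions of all indices are at most
  \<open>d\<close>, so no term is left out of the score.\<close>
lemma activity_score_full:
  assumes "eigenvalue_decomposition C U l"
  shows "activity_score U l i CARD('n) = C $ i $ (i :: 'n::{finite,linorder})"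
proof -
  have C: "C = U ** diag_matrix l ** transpose U"
    using assms by (simp add: eigenvalue_decomposition_def)
  have "{j :: 'n. card {..j} \<le> CARD('n)} = UNIV" by (auto intro: card_mono)
  moreover have "(U ** diag_matrix l) $ i $ j = U $ i $ j * l $ j" for j
    by (simp add: matrix_matrix_mult_def diag_matrix_def if_distrib cong: if_cong)
  then have "C $ i $ i = (\<Sum>j\<in>UNIV. (U $ i $ j * l $ j) * U $ i $ j)"
    unfolding C by (subst matrix_matrix_mult_def) (simp add: transpose_def)
  ultimately show ?thesis
    by (simp add: activity_score_def power2_eq_square mult_ac)
qed

section \<open>Measurability from continuous second partial derivatives\<close>

lemma has_partial_derivative_line:
  assumes "has_partial_derivative F i D (y + t *\<^sub>R axis i 1)"
  shows "((\<lambda>s. F (y + s *\<^sub>R axis i 1)) has_real_derivative D) (at t)"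
proof -
  have "((\<lambda>s. F (y + (s + t) *\<^sub>R axis i 1)) has_real_derivative D) (at 0)"
    using assms by (simp add: has_partial_derivative_def algebra_simps)
  then show ?thesis using DERIV_shift[of "\<lambda>s. F (y + s *\<^sub>R axis i 1)" D 0 t] by simp
qed

text \<open>Passing from \<open>x0\<close> to \<open>x\<close> one coordinate at a time, through the points \<open>mix u x x0\<close>, the mean value
  theorem bounds each step by \<open>B i * \<bar>x $ i - x0 $ i\<bar>\<close>. No point on the way is farther from \<open>x0\<close>
  than \<open>x\<close>.\<close>
lemma isCont_if_locally_bounded_partials:
  fixes F :: "real ^ 'n::finite \<Rightarrow> real"
  assumes S: "open S" "x0 \<in> S"
    and partial: "\<And>i x. x \<in> S \<Longrightarrow> has_partial_derivative F i (G i x) x"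
    and bound: "\<And>i. eventually (\<lambda>x. \<bar>G i x\<bar> \<le> B i) (nhds x0)"
  shows "isCont F x0"
proof -
  have "eventually (\<lambda>x. x \<in> S \<and> (\<forall>i. \<bar>G i x\<bar> \<le> B i)) (nhds x0)"
    using bound S by (intro eventually_conj eventually_nhds_in_open eventually_all_finite) auto
  then obtain e where e: "e > 0" and near: "\<And>x. dist x x0 < e \<Longrightarrow> x \<in> S \<and> (\<forall>i. \<bar>G i x\<bar> \<le> B i)"
    by (auto simp: eventually_nhds_metric)
  have diff: "\<bar>F (mix u x x0) - F x0\<bar> \<le> (\<Sum>i\<in>u. B i * \<bar>x $ i - x0 $ i\<bar>)" if x: "dist x x0 < e" for u x
  proof (induction u rule: finite_induct[OF finite])
    case (2 i u)
    let ?y = "mix u x x0" and ?s = "x $ i - x0 $ i"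
    let ?h = "\<lambda>t. F (?y + t *\<^sub>R axis i 1)"
    have close: "dist (?y + t *\<^sub>R axis i 1) x0 < e" if "t \<in> closed_segment 0 ?s" for t
    proof -
      have t: "\<bar>t\<bar> \<le> \<bar>?s\<bar>" using that by (auto simp: closed_segment_eq_real_ivl split: if_splits)
      have "norm (?y + t *\<^sub>R axis i 1 - x0) \<le> norm (x - x0)"
        using t \<open>i \<notin> u\<close>
        by (intro norm_le_componentwise_cart) (auto simp: mix_component axis_def)
      then show ?thesis using x by (simp add: dist_norm)
    qed
    note line = has_field_derivative_at_within[OF has_partial_derivative_line[of F i _ ?y]]
    have "norm (?h ?s - ?h 0) \<le> B i * norm (?s - 0)"
    proof (rule field_differentiable_bound[of "closed_segment 0 ?s" ?h "\<lambda>t. G i (?y + t *\<^sub>R axis i 1)"])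
      fix t assume t: "t \<in> closed_segment 0 ?s"
      show "(?h has_field_derivative G i (?y + t *\<^sub>R axis i 1)) (at t within closed_segment 0 ?s)"
        using near[OF close[OF t]] by (intro line[OF partial]) simp
      show "norm (G i (?y + t *\<^sub>R axis i 1)) \<le> B i" using near[OF close[OF t]] by simp
    qed auto
    moreover have "?y + ?s *\<^sub>R axis i 1 = mix (insert i u) x x0"
      using \<open>i \<notin> u\<close> by (auto simp: vec_eq_iff mix_component axis_def)
    ultimately have "\<bar>F (mix (insert i u) x x0) - F ?y\<bar> \<le> B i * \<bar>?s\<bar>" by simp
    then show ?case using 2 by simp
  qed simp
  have "eventually (\<lambda>x. norm (F x - F x0) \<le> (\<Sum>i\<in>UNIV. B i * \<bar>x $ i - x0 $ i\<bar>)) (at x0)"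
    using diff[of _ UNIV] e by (auto simp: eventually_at)
  moreover have "((\<lambda>x. \<Sum>i\<in>UNIV. B i * \<bar>x $ i - x0 $ i\<bar>) \<longlongrightarrow> (\<Sum>i\<in>UNIV. B i * \<bar>x0 $ i - x0 $ i\<bar>)) (at x0)"
    by (intro tendsto_intros)
  then have "((\<lambda>x. \<Sum>i\<in>UNIV. B i * \<bar>x $ i - x0 $ i\<bar>) \<longlongrightarrow> 0) (at x0)" by simp
  ultimately have "((\<lambda>x. F x - F x0) \<longlongrightarrow> 0) (at x0)" by (rule Lim_null_comparison)
  then show ?thesis by (simp add: isCont_def LIM_zero_iff)
qed

lemma isCont_if_continuous_partials:
  fixes F :: "real ^ 'n::finite \<Rightarrow> real"
  assumes S: "open S" "x0 \<in> S"
    and partial: "\<And>i x. x \<in> S \<Longrightarrow> has_partial_derivative F i (G i x) x"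
    and cont: "\<And>i. isCont (G i) x0"
  shows "isCont F x0"
proof (rule isCont_if_locally_bounded_partials[OF S partial])
  fix i
  have "((\<lambda>x. \<bar>G i x\<bar>) \<longlongrightarrow> \<bar>G i x0\<bar>) (nhds x0)"
    using cont[of i] by (intro tendsto_rabs) (simp add: isCont_def tendsto_nhds_iff continuous_within)
  then have "eventually (\<lambda>x. \<bar>G i x\<bar> < \<bar>G i x0\<bar> + 1) (nhds x0)"
    by (rule order_tendstoD) simp
  then show "eventually (\<lambda>x. \<bar>G i x\<bar> \<le> \<bar>G i x0\<bar> + 1) (nhds x0)"
    by (rule eventually_mono) simp
qed auto

text \<open>The previous lemma applies twice: the first partials are continuous because the second ones are,
  and then \<open>f\<close> is.\<close>
lemma continuous_on_if_cont_second_partials_on: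
  assumes S: "open S" and f: "cont_second_partials_on S f"
  shows "continuous_on S f"
proof -
  obtain g h where g: "\<And>i x. x \<in> S \<Longrightarrow> has_partial_derivative f i (g i x) x"
    and h: "\<And>i j x. x \<in> S \<Longrightarrow> has_partial_derivative (g i) j (h i j x) x"
    and cont: "\<And>i j. continuous_on S (h i j)"
    using f unfolding cont_second_partials_on_def by blast
  have "isCont f x" if x: "x \<in> S" for x
  proof (rule isCont_if_continuous_partials[OF S x g])
    show "isCont (g i) x" for i
      by (rule isCont_if_continuous_partials[OF S x h])
         (use cont x S in \<open>auto simp: continuous_on_eq_continuous_at\<close>)
  qed
  then show ?thesis using S by (simp add: continuous_on_eq_continuous_at)
qed

lemma bounded_measurable_if_smooth:
  assumes "bounded (f ` unit_cube)" and "cont_second_partials_on unit_cube f"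
  shows "bounded_measurable f"
proof -
  have "f \<in> borel_measurable (restrict_space borel unit_cube)"
    by (intro borel_measurable_continuous_on_restrict continuous_on_if_cont_second_partials_on assms unit_cube_open)
  then show ?thesis
    using assms(1) measurable_cong_sets[OF sets_unif refl] by (auto simp: bounded_measurable_def)
qed

section \<open>Upper Sobol' indices and activity scores\<close>

theorem theorem3p2:
  fixes f :: "real ^ 'n::{finite,linorder} \<Rightarrow> real"
    and U :: "real ^ 'n::{finite,linorder} ^ 'n::{finite,linorder}" and l :: "real ^ 'n::{finite,linorder}" and i :: 'n
  assumes "integrable unif (\<lambda>x. (f x)\<^sup>2)"
    and "bounded (f ` unit_cube)"
    and "cont_second_partials_on unit_cube f"
    and "var f > 0"
    and "C_gas_finite f"
    and "eigenvalue_decomposition (C_gas f) U l"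
  shows "upper_sobol f i \<le> 1 / 2 * (activity_score U l i CARD('n) / var f)"
proof -
  have f: "bounded_measurable f" by (rule bounded_measurable_if_smooth[OF assms(2,3)])
  have gas: "integrable vz_space (gas_integrand f i i)"
    using assms(5) by (simp add: C_gas_finite_def)
  have "(\<Sum>u | i \<in> u. var (anova f u)) \<le> (\<Sum>u | i \<in> u. unif_inner (anova f u) (anova f u))"
    by (intro sum_mono variance_le_second_moment bounded_measurable_anova f)
  also have "\<dots> = 1 / 2 * (\<integral>(v, z). (f (mix {i} v z) - f z)\<^sup>2 \<partial>vz_space)"
    by (rule sum_anova_sq_eq[OF f])
  also have "(\<integral>(v, z). (f (mix {i} v z) - f z)\<^sup>2 \<partial>vz_space) \<le> (\<integral>p. gas_integrand f i i p \<partial>vz_space)"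
    by (rule integral_mono_AE'[OF gas])
       (auto simp: space_vz sq_increment_le_gas_integrand gas_integrand_nonneg intro!: AE_I2)
  also have "\<dots> = C_gas f $ i $ i" by (rule C_gas_entry[OF assms(5), symmetric])
  also have "\<dots> = activity_score U l i CARD('n)" by (rule activity_score_full[OF assms(6), symmetric])
  finally have "(\<Sum>u | i \<in> u. var (anova f u)) \<le> 1 / 2 * activity_score U l i CARD('n)" by simp
  from divide_right_mono[OF this, of "var f"] show ?thesis
    using assms(4) by (simp add: upper_sobol_def)
qed

end
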